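(* Let $\Gamma(N)$ be a parking spot selection game with $N>1$ drivers, $R\geq 1$ public spots and cost parameters $1<\beta<\gamma$, and let $\delta=\gamma-\beta$ and $\sigma_0=\frac{R(\gamma-1)}{\delta}$. The pure Price of Anarchy of $\Gamma(N)$ equals $$\mathrm{PoA}=\begin{cases}\dfrac{\gamma N-(\gamma-1)\min(N,R)}{\min(N,R)+\beta\max(0,N-R)}, & \text{if }\sigma_0\geq N,\\[2ex] \dfrac{\lfloor\sigma_0\rfloor\delta-R(\gamma-1)+\beta N}{R+\beta(N-R)}, & \text{if }\sigma_0<N.\end{cases}$$
   Context: Parking spot selection game $\Gamma(N)$: there is a set $\mathcal{N}=\{1,\dots,N\}$ of $N>1$ drivers, $R\geq 1$ public parking spots (an integer), and at least $N$ private spots. Each driver $i$ has action set $A_i=\{public, private\}$. Fix $c_{pub,s}>0$ and reals $1<\beta<\gamma$; put $c_{pub,f}=\gamma c_{pub,s}$, $c_{priv}=\beta c_{pub,s}$, $\delta=\gamma-\beta>0$. If $k\ge 1$ drivers in total play $public$, each of them incurs the (expected) cost $$w_{pub}(k)=\min(1,R/k)\,c_{pub,s}+(1-\min(1,R/k))\,c_{pub,f},$$ and each driver playing $private$ incurs the constant cost $c_{priv}$. For an action profile $a\in\{public,private\}^N$, let $\sigma_{pub}(a)$ be the number of drivers playing $public$; the cost $c_i^N(a)$ of driver $i$ is $w_{pub}(\sigma_{pub}(a))$ if $a_i=public$ and $c_{priv}$ if $a_i=private$. Drivers are cost minimizers. A profile $a=(a_i,a_{-i})$ is a (pure) Nash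 equilibrium if for every $i$, $a_i\in\arg\min_{a_i'\in A_i}c_i^N(a_i',a_{-i})$. The social cost of $a$ is $\sum_{i=1}^N c_i^N(a)$. The pure Price of Anarchy is the ratio of the maximum social cost over all pure Nash equilibria to the minimum social cost over all action profiles. *)

theory Defs
  imports Complex_Main "HOL-Library.FuncSet"
begin

text \<open>Finite cost games with player set \<open>I\<close>, action sets \<open>A i\<close> and costs \<open>c i a\<close>.
  A profile is an element of \<open>PiE I A\<close>, so it takes the value \<open>undefined\<close> outside \<open>I\<close>;
  this makes the set of profiles finite when \<open>I\<close> and all \<open>A i\<close> are.\<close>

definition pure_nash :: "'i set \<Rightarrow> ('i \<Rightarrow> 'x set) \<Rightarrow> ('i \<Rightarrow> ('i \<Rightarrow> 'x) \<Rightarrow> real) \<Rightarrow> ('i \<Rightarrow> 'x) \<Rightarrow> bool"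
  where "pure_nash I A c a \<longleftrightarrow>
    a \<in> PiE I A \<and> (\<forall>i\<in>I. is_arg_min (\<lambda>x. c i (a(i := x))) (\<lambda>x. x \<in> A i) (a i))"

definition social_cost :: "'i set \<Rightarrow> ('i \<Rightarrow> ('i \<Rightarrow> 'x) \<Rightarrow> real) \<Rightarrow> ('i \<Rightarrow> 'x) \<Rightarrow> real"
  where "social_cost I c a = (\<Sum>i\<in>I. c i a)"

text \<open>The numerator is meaningful only if a pure Nash equilibrium exists, because \<open>Max {}\<close> is
  unspecified.\<close>

definition pure_PoA :: "'i set \<Rightarrow> ('i \<Rightarrow> 'x set) \<Rightarrow> ('i \<Rightarrow> ('i \<Rightarrow> 'x) \<Rightarrow> real) \<Rightarrow> real"
  where "pure_PoA I A c =
    Max (social_cost I c ` {a. pure_nash I A c a}) / Min (social_cost I c ` PiE I A)"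

datatype action = Public | Private

definition drivers :: "nat \<Rightarrow> nat set"
  where "drivers N = {1..N}"

definition actions :: "nat \<Rightarrow> action set"
  where "actions i = {Public, Private}"

definition \<sigma>_pub :: "nat \<Rightarrow> (nat \<Rightarrow> action) \<Rightarrow> nat"
  where "\<sigma>_pub N a = card {i \<in> drivers N. a i = Public}"

text \<open>Only used for \<open>k \<ge> 1\<close>.\<close>

definition w_pub :: "nat \<Rightarrow> real \<Rightarrow> real \<Rightarrow> nat \<Rightarrow> real"
  where "w_pub R c_pub_s c_pub_f k =
    min 1 (real R / real k) * c_pub_s + (1 - min 1 (real R / real k)) * c_pub_f"

definition parking_cost ::
    "nat \<Rightarrow> nat \<Rightarrow> real \<Rightarrow> real \<Rightarrow> real \<Rightarrow> nat \<Rightarrow> (nat \<Rightarrow> action) \<Rightarrow> real"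
  where "parking_cost N R c_pub_s c_pub_f c_priv i a =
    (case a i of Public \<Rightarrow> w_pub R c_pub_s c_pub_f (\<sigma>_pub N a) | Private \<Rightarrow> c_priv)"

end

(* The social cost of a profile depends only on its number k of public players: in units of c_pub_s it
   is \<beta> N + \<delta> k - (\<gamma> - 1) min k R, which decreases for k \<le> R and increases for k \<ge> R, so the optimum is
   at k = min N R.  For k \<ge> 1, w_pub k \<le> c_priv iff k \<le> \<sigma>\<^sub>0, so k is the count of an equilibrium iff
   k \<le> \<sigma>\<^sub>0 and either k = N or k \<ge> \<sigma>\<^sub>0 - 1.  Since \<sigma>\<^sub>0 > R, every such k < N lies on the increasing
   branch, and the worst equilibrium has k = min N \<lfloor>\<sigma>\<^sub>0\<rfloor>. *)

theory Submission
  imports Defs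
begin

section \<open>Counting the public players of a profile\<close>

lemma finite_drivers [simp]: "finite (drivers N)"
  and card_drivers [simp]: "card (drivers N) = N"
  by (simp_all add: drivers_def)

lemma finite_profiles: "finite (PiE (drivers N) actions)"
  by (intro finite_PiE) (simp_all add: actions_def)

lemma \<sigma>_pub_le: "\<sigma>_pub N a \<le> N"
proof -
  have "\<sigma>_pub N a \<le> card (drivers N)"
    unfolding \<sigma>_pub_def by (rule card_mono) auto
  then show ?thesis by simp
qed

lemma \<sigma>_pub_eq_0_iff: "\<sigma>_pub N a = 0 \<longleftrightarrow> (\<forall>i\<in>drivers N. a i \<noteq> Public)"
  by (auto simp: \<sigma>_pub_def)

lemma \<sigma>_pub_eq_N_iff: "\<sigma>_pub N a = N \<longleftrightarrow> (\<forall>i\<in>drivers N. a i = Public)"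
proof
  assume "\<sigma>_pub N a = N"
  then have "{i \<in> drivers N. a i = Public} = drivers N"
    by (intro card_subset_eq) (auto simp: \<sigma>_pub_def)
  then show "\<forall>i\<in>drivers N. a i = Public" by blast
next
  assume "\<forall>i\<in>drivers N. a i = Public"
  then have "{i \<in> drivers N. a i = Public} = drivers N" by blast
  then show "\<sigma>_pub N a = N" by (simp add: \<sigma>_pub_def)
qed

lemma \<sigma>_pub_upd_Public:
  assumes "i \<in> drivers N" "a i = Private"
  shows "\<sigma>_pub N (a(i := Public)) = Suc (\<sigma>_pub N a)"
proof -
  have "{j \<in> drivers N. (a(i := Public)) j = Public} = insert i {j \<in> drivers N. a j = Public}"
    using assms(1) by auto
  then show ?thesis using assms(2) by (simp add: \<sigma>_pub_def)
qed

lemma ex_profile_\<sigma>_pub: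
  assumes "k \<le> N"
  obtains a where "a \<in> PiE (drivers N) actions" "\<sigma>_pub N a = k"
proof
  \<comment> \<open>The restricted abstraction is \<open>undefined\<close> outside
    \<open>drivers N\<close>, as membership in \<open>PiE\<close> demands.\<close>
  let ?a = "\<lambda>i\<in>drivers N. if i \<le> k then Public else Private"
  show "?a \<in> PiE (drivers N) actions" by (auto simp: actions_def)
  have "{i \<in> drivers N. ?a i = Public} = {1..k}"
    using assms by (auto simp: drivers_def split: if_splits)
  then show "\<sigma>_pub N ?a = k" by (simp add: \<sigma>_pub_def)
qed

section \<open>Costs and equilibria in terms of the number of public players\<close>

lemma social_cost_parking:
  "social_cost (drivers N) (parking_cost N R s f p) a =
    real (\<sigma>_pub N a) * w_pub R s f (\<sigma>_pub N a) + (real N - real (\<sigma>_pub N a)) * p"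
proof -
  let ?P = "{i. a i = Public}" and ?w = "w_pub R s f (\<sigma>_pub N a)"
  have card_pub: "card (drivers N \<inter> ?P) = \<sigma>_pub N a"
    by (simp add: \<sigma>_pub_def Collect_conj_eq)
  have "card (drivers N \<inter> - ?P) = card (drivers N) - card (drivers N \<inter> ?P)"
    using card_Diff_subset_Int[of "drivers N" ?P] by (simp add: Diff_eq)
  then have card_priv: "card (drivers N \<inter> - ?P) = N - \<sigma>_pub N a"
    using card_pub by simp
  have "social_cost (drivers N) (parking_cost N R s f p) a
      = (\<Sum>i\<in>drivers N. if a i = Public then ?w else p)"
    unfolding social_cost_def
    by (intro sum.cong) (auto simp: parking_cost_def split: action.split)
  also have "\<dots> = real (\<sigma>_pub N a) * ?w + real (N - \<sigma>_pub N a) * p"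
    using card_pub card_priv by (simp add: sum.If_cases)
  finally show ?thesis by (simp add: of_nat_diff \<sigma>_pub_le)
qed

text \<open>All players with the same action face the same comparison, so the condition on all
  players collapses to one inequality per action. The disjuncts \<open>\<sigma>_pub N a = 0\<close>
  and \<open>\<sigma>_pub N a = N\<close> cover the case that nobody plays that action. The
  \<open>Suc\<close> arises because a private player who deviates joins the public ones.\<close>

lemma pure_nash_parking_iff:
  "pure_nash (drivers N) actions (parking_cost N R s f p) a \<longleftrightarrow>
    a \<in> PiE (drivers N) actions \<and>
    (\<sigma>_pub N a = 0 \<or> w_pub R s f (\<sigma>_pub N a) \<le> p) \<and>
    (\<sigma>_pub N a = N \<or> p \<le> w_pub R s f (Suc (\<sigma>_pub N a)))"
proof -
  let ?k = "\<sigma>_pub N a"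
  have best_response:
    "is_arg_min (\<lambda>x. parking_cost N R s f p i (a(i := x))) (\<lambda>x. x \<in> actions i) (a i) \<longleftrightarrow>
      (if a i = Public then w_pub R s f ?k \<le> p else p \<le> w_pub R s f (Suc ?k))"
    if "i \<in> drivers N" for i
  proof (cases "a i")
    case Public
    then have "a(i := Public) = a" by auto
    with Public show ?thesis
      by (auto simp: is_arg_min_def actions_def parking_cost_def)
  next
    case Private
    with that show ?thesis
      by (auto simp: is_arg_min_def actions_def parking_cost_def \<sigma>_pub_upd_Public)
  qed
  have "(\<forall>i\<in>drivers N. if a i = Public then w_pub R s f ?k \<le> p else p \<le> w_pub R s f (Suc ?k)) \<longleftrightarrow>
      (?k = 0 \<or> w_pub R s f ?k \<le> p) \<and> (?k = N \<or> p \<le> w_pub R s f (Suc ?k))"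
    unfolding \<sigma>_pub_eq_0_iff \<sigma>_pub_eq_N_iff by auto
  with best_response show ?thesis unfolding pure_nash_def by simp
qed

text \<open>Among \<open>k\<close> public players, \<open>k * min 1 (R / k) = min k R\<close> find a
  public spot and each of them saves \<open>(\<gamma> - 1) * s\<close>. For \<open>k = 0\<close>
  both sides vanish, whatever the value of the quotient.\<close>

lemma mult_w_pub:
  "real k * w_pub R s (\<gamma> * s) k = (\<gamma> * real k - (\<gamma> - 1) * min (real k) (real R)) * s"
proof (cases "k = 0")
  case False
  have "real k * min 1 (real R / real k) = min (real k) (real R)"
    using False by (simp add: min_def field_simps)
  moreover have "real k * w_pub R s (\<gamma> * s) k
      = (\<gamma> * real k - (\<gamma> - 1) * (real k * min 1 (real R / real k))) * s"
    by (simp add: w_pub_def algebra_simps)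
  ultimately show ?thesis by simp
qed simp

text \<open>Multiplying \<open>w_pub - \<beta> * s\<close> by \<open>k / s > 0\<close> gives
  \<open>?D\<close>. The threshold comes from \<open>?E\<close>, where \<open>R\<close> replaces
  \<open>min k R\<close>; the two expressions always have the same sign.\<close>

lemma w_pub_threshold:
  fixes \<beta> \<gamma> s :: real
  assumes "k > 0" "s > 0" "1 < \<beta>" "\<beta> < \<gamma>"
  shows "w_pub R s (\<gamma> * s) k \<le> \<beta> * s \<longleftrightarrow> real k \<le> real R * (\<gamma> - 1) / (\<gamma> - \<beta>)"
    and "\<beta> * s \<le> w_pub R s (\<gamma> * s) k \<longleftrightarrow> real R * (\<gamma> - 1) / (\<gamma> - \<beta>) \<le> real k"
proof -
  let ?D = "(\<gamma> - \<beta>) * real k - (\<gamma> - 1) * min (real k) (real R)"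
  let ?E = "(\<gamma> - \<beta>) * real k - real R * (\<gamma> - 1)"
  have "real k * (w_pub R s (\<gamma> * s) k - \<beta> * s) = ?D * s"
    by (simp only: right_diff_distrib mult_w_pub) (simp add: algebra_simps)
  then have "w_pub R s (\<gamma> * s) k - \<beta> * s = ?D * (s / real k)"
    using assms(1) by (simp add: field_simps)
  moreover have "s / real k > 0" using assms by simp
  ultimately have w: "w_pub R s (\<gamma> * s) k - \<beta> * s \<le> 0 \<longleftrightarrow> ?D \<le> 0"
      "0 \<le> w_pub R s (\<gamma> * s) k - \<beta> * s \<longleftrightarrow> 0 \<le> ?D"
    by (simp_all only: mult_le_0_iff zero_le_mult_iff) auto
  have "?D \<le> 0 \<longleftrightarrow> ?E \<le> 0" "0 \<le> ?D \<longleftrightarrow> 0 \<le> ?E"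
  proof -
    \<comment> \<open>For \<open>k \<le> R\<close>, \<open>?D\<close> is
      \<open>(1 - \<beta>) * k < 0\<close>, and \<open>?E \<le> ?D\<close> because
      \<open>R \<ge> k\<close>. For \<open>R < k\<close> the two coincide.\<close>
    consider "R \<ge> k" "?D < 0" "?E < 0" | "R < k"
    proof (cases "R \<ge> k")
      case True
      have "?D = (1 - \<beta>) * real k" using True by (simp add: min_def algebra_simps)
      then have "?D < 0" using assms by (simp add: mult_neg_pos)
      moreover have "(\<gamma> - 1) * real k \<le> (\<gamma> - 1) * real R"
        using True assms by (intro mult_left_mono) auto
      ultimately show ?thesis using that(1)[OF True] True by (simp add: min_def algebra_simps)
    qed (use that(2) in simp)
    then show "?D \<le> 0 \<longleftrightarrow> ?E \<le> 0" "0 \<le> ?D \<longleftrightarrow> 0 \<le> ?E"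
      by (cases; simp add: algebra_simps)+
  qed
  moreover have "?E \<le> 0 \<longleftrightarrow> real k \<le> real R * (\<gamma> - 1) / (\<gamma> - \<beta>)"
    "0 \<le> ?E \<longleftrightarrow> real R * (\<gamma> - 1) / (\<gamma> - \<beta>) \<le> real k"
    using assms by (simp_all add: field_simps)
  ultimately show "w_pub R s (\<gamma> * s) k \<le> \<beta> * s \<longleftrightarrow> real k \<le> real R * (\<gamma> - 1) / (\<gamma> - \<beta>)"
    "\<beta> * s \<le> w_pub R s (\<gamma> * s) k \<longleftrightarrow> real R * (\<gamma> - 1) / (\<gamma> - \<beta>) \<le> real k"
    using w by linarith+
qed

section \<open>Social cost as a function of the number of public players\<close>

definition public_social_cost :: "nat \<Rightarrow> nat \<Rightarrow> real \<Rightarrow> real \<Rightarrow> nat \<Rightarrow> real"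
  where "public_social_cost N R \<beta> \<gamma> k =
    \<beta> * real N + (\<gamma> - \<beta>) * real k - (\<gamma> - 1) * min (real k) (real R)"

lemma social_cost_eq_public_social_cost:
  "social_cost (drivers N) (parking_cost N R s (\<gamma> * s) (\<beta> * s)) a =
    public_social_cost N R \<beta> \<gamma> (\<sigma>_pub N a) * s"
  unfolding social_cost_parking mult_w_pub public_social_cost_def by (simp add: algebra_simps)

lemma public_social_cost_mono:
  assumes "\<beta> < \<gamma>" "R \<le> k" "k \<le> l"
  shows "public_social_cost N R \<beta> \<gamma> k \<le> public_social_cost N R \<beta> \<gamma> l"
  using assms by (simp add: public_social_cost_def)

text \<open>Up to \<open>R\<close>, every further public player finds a spot, so the slope is
  \<open>(\<gamma> - \<beta>) - (\<gamma> - 1) = 1 - \<beta> < 0\<close>.\<close>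

lemma public_social_cost_antimono:
  assumes "1 < \<beta>" "k \<le> l" "l \<le> R"
  shows "public_social_cost N R \<beta> \<gamma> l \<le> public_social_cost N R \<beta> \<gamma> k"
proof -
  have "(\<beta> - 1) * real k \<le> (\<beta> - 1) * real l"
    using assms by (intro mult_left_mono) auto
  then show ?thesis using assms by (simp add: public_social_cost_def min_def algebra_simps)
qed

lemma Min_social_cost_parking:
  assumes "s > 0" "1 < \<beta>" "\<beta> < \<gamma>"
  shows "Min (social_cost (drivers N) (parking_cost N R s (\<gamma> * s) (\<beta> * s)) ` PiE (drivers N) actions) =
    public_social_cost N R \<beta> \<gamma> (min N R) * s"
proof (rule Min_eqI)
  fix y assume "y \<in> social_cost (drivers N) (parking_cost N R s (\<gamma> * s) (\<beta> * s)) ` PiE (drivers N) actions"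
  then obtain a where y: "y = public_social_cost N R \<beta> \<gamma> (\<sigma>_pub N a) * s"
    by (auto simp: social_cost_eq_public_social_cost)
  have "public_social_cost N R \<beta> \<gamma> (min N R) \<le> public_social_cost N R \<beta> \<gamma> (\<sigma>_pub N a)"
  proof (cases "\<sigma>_pub N a \<le> R")
    case True
    then show ?thesis using assms \<sigma>_pub_le[of N a] by (intro public_social_cost_antimono) auto
  next
    case False
    then show ?thesis using assms \<sigma>_pub_le[of N a] by (intro public_social_cost_mono) auto
  qed
  then show "public_social_cost N R \<beta> \<gamma> (min N R) * s \<le> y"
    using assms unfolding y by simp
next
  obtain a where "a \<in> PiE (drivers N) actions" "\<sigma>_pub N a = min N R"
    using ex_profile_\<sigma>_pub[of "min N R" N] by auto
  then show "public_social_cost N R \<beta> \<gamma> (min N R) * s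
      \<in> social_cost (drivers N) (parking_cost N R s (\<gamma> * s) (\<beta> * s)) ` PiE (drivers N) actions"
    by (force simp: social_cost_eq_public_social_cost)
qed (simp add: finite_profiles)

text \<open>Here \<open>m\<close> is the largest count compatible with both \<open>k \<le> N\<close>
  and the threshold. Showing that an equilibrium attains it also shows that \<open>Max\<close> is
  taken over a nonempty set.\<close>

lemma Max_nash_social_cost_parking:
  fixes N R :: nat and s \<beta> \<gamma> :: real
  defines "m \<equiv> min N (nat \<lfloor>real R * (\<gamma> - 1) / (\<gamma> - \<beta>)\<rfloor>)"
  assumes "R \<ge> 1" "s > 0" "1 < \<beta>" "\<beta> < \<gamma>"
  shows "Max (social_cost (drivers N) (parking_cost N R s (\<gamma> * s) (\<beta> * s)) `
      {a. pure_nash (drivers N) actions (parking_cost N R s (\<gamma> * s) (\<beta> * s)) a}) =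
    public_social_cost N R \<beta> \<gamma> m * s"
proof -
  let ?c = "parking_cost N R s (\<gamma> * s) (\<beta> * s)"
  let ?nash = "{a. pure_nash (drivers N) actions ?c a}"
  let ?\<sigma> = "real R * (\<gamma> - 1) / (\<gamma> - \<beta>)"
  \<comment> \<open>This follows from \<open>\<gamma> - 1 > \<gamma> - \<beta> > 0\<close> and
    \<open>R \<ge> 1\<close>. It makes \<open>?\<sigma>\<close> positive, so \<open>nat\<close> does
    not truncate the floor.\<close>
  have "real R < ?\<sigma>" using assms by (simp add: field_simps)
  then have le_floor: "k \<le> nat \<lfloor>?\<sigma>\<rfloor> \<longleftrightarrow> real k \<le> ?\<sigma>" for k
    by (simp add: le_nat_floor le_floor_iff le_nat_iff)
  have nash_iff: "a \<in> ?nash \<longleftrightarrow> a \<in> PiE (drivers N) actions \<and>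
      real (\<sigma>_pub N a) \<le> ?\<sigma> \<and> (\<sigma>_pub N a = N \<or> ?\<sigma> \<le> real (\<sigma>_pub N a) + 1)" for a
    \<comment> \<open>The threshold lemma needs a positive count. At count 0 the first condition is
      vacuous and agrees with \<open>0 \<le> ?\<sigma>\<close>; the second concerns a successor,
      which is always positive.\<close>
    using w_pub_threshold[OF _ \<open>s > 0\<close> \<open>1 < \<beta>\<close> \<open>\<beta> < \<gamma>\<close>, of _ R] \<open>real R < ?\<sigma>\<close>
    by (cases "\<sigma>_pub N a = 0") (auto simp: pure_nash_parking_iff add.commute)
  show ?thesis
  proof (rule Max_eqI)
    have "?nash \<subseteq> PiE (drivers N) actions" by (auto simp: pure_nash_def)
    then show "finite (social_cost (drivers N) ?c ` ?nash)"
      by (intro finite_imageI) (rule finite_subset[OF _ finite_profiles])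
  next
    fix y assume "y \<in> social_cost (drivers N) ?c ` ?nash"
    then obtain a where a: "a \<in> ?nash" and y: "y = public_social_cost N R \<beta> \<gamma> (\<sigma>_pub N a) * s"
      by (auto simp: social_cost_eq_public_social_cost)
    have le_m: "\<sigma>_pub N a \<le> m"
      using a \<sigma>_pub_le[of N a] unfolding m_def nash_iff by (simp add: le_floor)
    have "public_social_cost N R \<beta> \<gamma> (\<sigma>_pub N a) \<le> public_social_cost N R \<beta> \<gamma> m"
    proof (cases "\<sigma>_pub N a = N")
      case True
      then have "\<sigma>_pub N a = m" using le_m by (simp add: m_def)
      then show ?thesis by simp
    next
      case False
      \<comment> \<open>From \<open>R < ?\<sigma> \<le> k + 1\<close> for the count
        \<open>k\<close>, integrality gives \<open>R \<le> k\<close>.\<close>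
      then have "R \<le> \<sigma>_pub N a" using a \<open>real R < ?\<sigma>\<close> unfolding nash_iff by linarith
      then show ?thesis using \<open>\<beta> < \<gamma>\<close> le_m by (intro public_social_cost_mono)
    qed
    then show "y \<le> public_social_cost N R \<beta> \<gamma> m * s"
      using \<open>s > 0\<close> unfolding y by simp
  next
    obtain a where a: "a \<in> PiE (drivers N) actions" "\<sigma>_pub N a = m"
      using ex_profile_\<sigma>_pub[of m N] by (auto simp: m_def)
    have "real m \<le> ?\<sigma>" unfolding le_floor[symmetric] by (simp add: m_def)
    moreover have "m = N \<or> ?\<sigma> \<le> real m + 1"
    proof (cases "m = N")
      case False
      then have "m = nat \<lfloor>?\<sigma>\<rfloor>" by (simp add: m_def min_def split: if_splits)
      \<comment> \<open>The floor is the largest natural number below the threshold, so one more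
        public player exceeds it.\<close>
      then have "\<not> real (Suc m) \<le> ?\<sigma>" unfolding le_floor[symmetric] by simp
      then show ?thesis by simp
    qed simp
    ultimately have "a \<in> ?nash" unfolding nash_iff a(2) using a(1) by blast
    then have "social_cost (drivers N) ?c a \<in> social_cost (drivers N) ?c ` ?nash" by (rule imageI)
    then show "public_social_cost N R \<beta> \<gamma> m * s \<in> social_cost (drivers N) ?c ` ?nash"
      by (simp add: social_cost_eq_public_social_cost a(2))
  qed
qed

theorem proposition3p1:
  fixes N R R_priv :: nat
    and c_pub_s c_pub_f c_priv \<beta> \<gamma> \<delta> \<sigma>\<^sub>0 :: real
  assumes "N > 1" and "R \<ge> 1" and "R_priv \<ge> N"
    and "c_pub_s > 0" and "1 < \<beta>" and "\<beta> < \<gamma>"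
    and "c_pub_f = \<gamma> * c_pub_s" and "c_priv = \<beta> * c_pub_s"
    and "\<delta> = \<gamma> - \<beta>" and "\<sigma>\<^sub>0 = real R * (\<gamma> - 1) / \<delta>"
  shows "pure_PoA (drivers N) actions (parking_cost N R c_pub_s c_pub_f c_priv) =
    (if \<sigma>\<^sub>0 \<ge> real N
     then (\<gamma> * real N - (\<gamma> - 1) * min (real N) (real R))
            / (min (real N) (real R) + \<beta> * max 0 (real N - real R))
     else (of_int \<lfloor>\<sigma>\<^sub>0\<rfloor> * \<delta> - real R * (\<gamma> - 1) + \<beta> * real N)
            / (real R + \<beta> * (real N - real R)))"
proof -
  let ?m = "min N (nat \<lfloor>\<sigma>\<^sub>0\<rfloor>)"
  let ?C = "public_social_cost N R \<beta> \<gamma>"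
  have "real R < \<sigma>\<^sub>0"
    unfolding assms(9,10) using assms(2,5,6) by (simp add: field_simps)
  \<comment> \<open>The common positive factor \<open>c_pub_s\<close> cancels in the
    quotient.\<close>
  have PoA: "pure_PoA (drivers N) actions (parking_cost N R c_pub_s c_pub_f c_priv) = ?C ?m / ?C (min N R)"
    using assms by (simp add: pure_PoA_def Max_nash_social_cost_parking Min_social_cost_parking)
  \<comment> \<open>With \<open>k = min N R\<close> public players the cost is
    \<open>k + \<beta> * (N - k)\<close>, and \<open>N - k = max 0 (N - R)\<close> over the
    reals.\<close>
  have opt: "?C (min N R) = min (real N) (real R) + \<beta> * max 0 (real N - real R)"
    by (auto simp: public_social_cost_def min_def max_def algebra_simps)
  show ?thesis
  proof (cases "\<sigma>\<^sub>0 \<ge> real N")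
    case True
    then have "?m = N" by (simp add: le_nat_floor)
    then have "?C ?m = \<gamma> * real N - (\<gamma> - 1) * min (real N) (real R)"
      by (simp add: public_social_cost_def algebra_simps)
    then show ?thesis using True PoA opt by simp
  next
    case False
    then have "R < N" using \<open>real R < \<sigma>\<^sub>0\<close> by linarith
    \<comment> \<open>This puts the worst count on the branch where \<open>min k R = R\<close>,
      which yields the term \<open>R * (\<gamma> - 1)\<close> of the numerator.\<close>
    have "int R \<le> \<lfloor>\<sigma>\<^sub>0\<rfloor>" using \<open>real R < \<sigma>\<^sub>0\<close> by (simp add: le_floor_iff)
    moreover have "\<lfloor>\<sigma>\<^sub>0\<rfloor> < int N" using False by (simp add: floor_less_iff)
    ultimately have "?m = nat \<lfloor>\<sigma>\<^sub>0\<rfloor>" "real (nat \<lfloor>\<sigma>\<^sub>0\<rfloor>) = of_int \<lfloor>\<sigma>\<^sub>0\<rfloor>"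
        "real R \<le> of_int \<lfloor>\<sigma>\<^sub>0\<rfloor>"
      by linarith+
    then have "?C ?m = of_int \<lfloor>\<sigma>\<^sub>0\<rfloor> * \<delta> - real R * (\<gamma> - 1) + \<beta> * real N"
      unfolding \<open>\<delta> = \<gamma> - \<beta>\<close> by (simp add: public_social_cost_def algebra_simps)
    then show ?thesis using False PoA opt \<open>R < N\<close> by simp
  qed
qed

end
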